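(* Let $\mathcal{A},\mathcal{B}\in\mathbb{C}^{\mathbf{N}(n)\times\mathbf{N}(n)}$ be two core tensors. If $\mathcal{A}^2=\mathcal{B}*_n\mathcal{A}$, then: (a) $\mathrm{ind}(\mathcal{A}*_n\mathcal{B})=1$ and $(\mathcal{A}*_n\mathcal{B})^{\mathrm{core}}=\mathcal{B}^{\mathrm{core}}*_n\mathcal{A}^{\mathrm{core}}$; (b) $\mathrm{ind}(\mathcal{A}*_n\mathcal{B}*_n\mathcal{B}^{\mathrm{core}})=1$ and $(\mathcal{A}*_n\mathcal{B}*_n\mathcal{B}^{\mathrm{core}})^{\mathrm{core}}=\mathcal{B}*_n\mathcal{B}^{\mathrm{core}}*_n\mathcal{A}^{\mathrm{core}}$.
   Context: Here $\mathbf{N}(n)=N_1\times\cdots\times N_n$ and $\mathbb{C}^{\mathbf{N}(n)\times\mathbf{N}(n)}$ is the set of complex tensors $\mathcal{A}=(a_{i_1\ldots i_n j_1\ldots j_n})$ with $1\le i_k,j_k\le N_k$. The Einstein product is $(\mathcal{A}*_n\mathcal{B})_{i_1\ldots i_n j_1\ldots j_n}=\sum_{k_1,\ldots,k_n}a_{i_1\ldots i_n k_1\ldots k_n}b_{k_1\ldots k_n j_1\ldots j_n}$ (and similarly $\mathcal{A}*_n\mathcal{X}\in\mathbb{C}^{\mathbf{N}(n)}$ for $\mathcal{X}\in\mathbb{C}^{\mathbf{N}(n)}$), powers are taken with respect to $*_n$, and $\mathcal{A}^*$ is the conjugate transpose (swap the first $n$ and last $n$ indices and conjugate). The range is $\mathscr{R}(\mathcal{A})=\{\mathcal{A}*_n\mathcal{X}:\mathcal{X}\in\mathbb{C}^{\mathbf{N}(n)}\}$.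 The index $\mathrm{ind}(\mathcal{A})$ is the smallest positive integer $k$ with $\mathscr{R}(\mathcal{A}^k)=\mathscr{R}(\mathcal{A}^{k+1})$; $\mathcal{A}$ is a core tensor if $\mathrm{ind}(\mathcal{A})=1$. The core inverse $\mathcal{A}^{\mathrm{core}}$ is the (unique, existing when $\mathcal{A}$ is a core tensor) tensor $\mathcal{X}$ with $(\mathcal{A}*_n\mathcal{X})^*=\mathcal{A}*_n\mathcal{X}$, $\mathcal{X}*_n\mathcal{A}^2=\mathcal{A}$, $\mathcal{A}*_n\mathcal{X}^2=\mathcal{X}$. *)

theory Defs
  imports Complex_Main "HOL-Library.FuncSet"
begin

text \<open>
  The sizes \<open>N 1, \<dots>, N n\<close> are given by a function \<open>N :: nat \<Rightarrow> nat\<close>, whose values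
  outside \<open>{1..n}\<close> play no role. A multi-index is an extensional function on
  \<open>{1..n}\<close>, and a tensor is an extensional function on its set of (pairs of) multi-indices,
  so equality in HOL of elements of the carrier sets below is entrywise equality.
\<close>

type_synonym multi_index = "nat \<Rightarrow> nat"
type_synonym ctensor = "multi_index \<times> multi_index \<Rightarrow> complex"
type_synonym cvtensor = "multi_index \<Rightarrow> complex"

definition multi_indices :: "(nat \<Rightarrow> nat) \<Rightarrow> nat \<Rightarrow> multi_index set" where
  "multi_indices N n = (\<Pi>\<^sub>E k\<in>{1..n}. {1..N k})"

definition tensors :: "(nat \<Rightarrow> nat) \<Rightarrow> nat \<Rightarrow> ctensor set" where
  "tensors N n = (multi_indices N n \<times> multi_indices N n \<rightarrow>\<^sub>E UNIV)"

definition vtensors :: "(nat \<Rightarrow> nat) \<Rightarrow> nat \<Rightarrow> cvtensor set" where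
  "vtensors N n = (multi_indices N n \<rightarrow>\<^sub>E UNIV)"

definition einstein :: "(nat \<Rightarrow> nat) \<Rightarrow> nat \<Rightarrow> ctensor \<Rightarrow> ctensor \<Rightarrow> ctensor" where
  "einstein N n A B =
    (\<lambda>(i, j) \<in> multi_indices N n \<times> multi_indices N n.
       \<Sum>k\<in>multi_indices N n. A (i, k) * B (k, j))"

definition einstein_apply :: "(nat \<Rightarrow> nat) \<Rightarrow> nat \<Rightarrow> ctensor \<Rightarrow> cvtensor \<Rightarrow> cvtensor" where
  "einstein_apply N n A X =
    (\<lambda>i \<in> multi_indices N n. \<Sum>k\<in>multi_indices N n. A (i, k) * X k)"

definition tensor_id :: "(nat \<Rightarrow> nat) \<Rightarrow> nat \<Rightarrow> ctensor" where
  "tensor_id N n =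
    (\<lambda>(i, j) \<in> multi_indices N n \<times> multi_indices N n. if i = j then 1 else 0)"

primrec tensor_power :: "(nat \<Rightarrow> nat) \<Rightarrow> nat \<Rightarrow> ctensor \<Rightarrow> nat \<Rightarrow> ctensor" where
  "tensor_power N n A 0 = tensor_id N n"
| "tensor_power N n A (Suc k) = einstein N n (tensor_power N n A k) A"

definition conj_transpose :: "(nat \<Rightarrow> nat) \<Rightarrow> nat \<Rightarrow> ctensor \<Rightarrow> ctensor" where
  "conj_transpose N n A =
    (\<lambda>(i, j) \<in> multi_indices N n \<times> multi_indices N n. cnj (A (j, i)))"

definition tensor_range :: "(nat \<Rightarrow> nat) \<Rightarrow> nat \<Rightarrow> ctensor \<Rightarrow> cvtensor set" where
  "tensor_range N n A = einstein_apply N n A ` vtensors N n"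

text \<open>The index is at least 1 by convention, also for invertible tensors.\<close>

definition tensor_ind :: "(nat \<Rightarrow> nat) \<Rightarrow> nat \<Rightarrow> ctensor \<Rightarrow> nat" where
  "tensor_ind N n A =
    (LEAST k. k \<ge> 1 \<and>
       tensor_range N n (tensor_power N n A k) = tensor_range N n (tensor_power N n A (k + 1)))"

definition core_tensor :: "(nat \<Rightarrow> nat) \<Rightarrow> nat \<Rightarrow> ctensor \<Rightarrow> bool" where
  "core_tensor N n A \<longleftrightarrow> A \<in> tensors N n \<and> tensor_ind N n A = 1"

definition is_core_inverse :: "(nat \<Rightarrow> nat) \<Rightarrow> nat \<Rightarrow> ctensor \<Rightarrow> ctensor \<Rightarrow> bool" where
  "is_core_inverse N n A X \<longleftrightarrow>
     X \<in> tensors N n \<and>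
     conj_transpose N n (einstein N n A X) = einstein N n A X \<and>
     einstein N n X (tensor_power N n A 2) = A \<and>
     einstein N n A (tensor_power N n X 2) = X"

text \<open>Unspecified when no core inverse exists, i.e. when \<open>A\<close> is not a core tensor.\<close>

definition core_inverse :: "(nat \<Rightarrow> nat) \<Rightarrow> nat \<Rightarrow> ctensor \<Rightarrow> ctensor" where
  "core_inverse N n A = (THE X. is_core_inverse N n A X)"

end

theory Submission imports Defs
begin

text \<open>
  Write \<open>X\<close> and \<open>Y\<close> for the core inverses of \<open>A\<close> and \<open>B\<close>. The hypothesis \<open>A\<^sup>2 = B A\<close> says that
  \<open>B\<close> agrees with \<open>A\<close> on the range of \<open>A\<close>. As \<open>A\<close> maps that range bijectively onto itself, so
  does \<open>B\<close>, and \<open>X\<close> and \<open>Y\<close> both invert this bijection. Because \<open>X\<close> takes values in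
  the range of \<open>A\<close>, it follows that \<open>Y X = X\<^sup>2\<close> and \<open>B Y X = X\<close>. Hence the claimed core inverses of
  \<open>A B\<close> and \<open>A B Y\<close> are just \<open>X\<^sup>2\<close> and \<open>X\<close>, and the defining equations are verified by
  calculations in a semigroup; in both cases the associated projector is \<open>A X\<close>
  (\<open>core_inverse_of_mult\<close>, \<open>core_inverse_of_mult_projection\<close>).

  The remaining work is to show that a core tensor has a unique core inverse, and that a tensor with
  a core inverse has index 1. Existence rests on finite dimension through a single fact: for each
  tensor \<open>M\<close> there are \<open>k\<close> and an \<open>S\<close> commuting with \<open>M\<close> such that \<open>M\<^sup>k = M\<^sup>k\<^sup>+\<^sup>1 S\<close>
  (\<open>tensor_power_eventually_divisible\<close>). Applied to \<open>A\<^sup>* A\<close>, together with the cancellation of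
  \<open>A\<^sup>*\<close> in \<open>A\<^sup>* A U = A\<^sup>* A W\<close>, it yields the orthogonal projector onto the range of \<open>A\<close>
  (\<open>exists_range_projector\<close>). Applied to \<open>A\<close> itself, where index 1 gives \<open>A = A\<^sup>2 W\<close>, it yields
  a \<open>V\<close> commuting with \<open>A\<close> such that \<open>V A\<^sup>2 = A\<close> (\<open>exists_commuting_divisor_square\<close>). The core
  inverse is the product of the group inverse \<open>A V\<^sup>2\<close> and the projector
  (\<open>core_tensor_is_core_inverse\<close>).
\<close>


section \<open>Core inverses in a semigroup\<close>

context semigroup
begin

text \<open>The equations \<open>x a\<^sup>2 = a\<close> and \<open>a x\<^sup>2 = x\<close> are the part of the definition of a core inverse
  that does not involve the involution. Self-adjointness enters only by determining the idempotent
  \<open>a x\<close>, which in turn determines \<open>x\<close>.\<close>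

lemma core_inverse_inner:
  assumes "x \<^bold>* (a \<^bold>* a) = a" and "a \<^bold>* (x \<^bold>* x) = x"
  shows "a \<^bold>* (x \<^bold>* a) = a" and "x \<^bold>* (a \<^bold>* x) = x"
proof -
  have "a \<^bold>* (x \<^bold>* a) = a \<^bold>* (x \<^bold>* (x \<^bold>* (a \<^bold>* a)))"
    by (simp add: assms(1))
  also have "\<dots> = (a \<^bold>* (x \<^bold>* x)) \<^bold>* (a \<^bold>* a)"
    by (simp only: assoc)
  finally show "a \<^bold>* (x \<^bold>* a) = a"
    by (simp add: assms)
  have "x \<^bold>* (a \<^bold>* x) = x \<^bold>* (a \<^bold>* (a \<^bold>* (x \<^bold>* x)))"
    by (simp add: assms(2))
  also have "\<dots> = (x \<^bold>* (a \<^bold>* a)) \<^bold>* (x \<^bold>* x)"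
    by (simp only: assoc)
  finally show "x \<^bold>* (a \<^bold>* x) = x"
    by (simp add: assms)
qed

lemma core_inverse_eqI:
  assumes x: "x \<^bold>* (a \<^bold>* a) = a" "a \<^bold>* (x \<^bold>* x) = x"
    and y: "y \<^bold>* (a \<^bold>* a) = a" "a \<^bold>* (y \<^bold>* y) = y"
    and proj: "a \<^bold>* x = a \<^bold>* y"
  shows "x = y"
proof -
  have "x = x \<^bold>* (a \<^bold>* (a \<^bold>* (y \<^bold>* y)))"
    using core_inverse_inner(2)[OF x] proj y(2) by simp
  also have "\<dots> = (x \<^bold>* (a \<^bold>* a)) \<^bold>* (y \<^bold>* y)"
    by (simp only: assoc)
  finally show ?thesis
    by (simp add: x y)
qed

context
  fixes a b x y
  assumes x: "x \<^bold>* (a \<^bold>* a) = a" "a \<^bold>* (x \<^bold>* x) = x"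
    and y: "y \<^bold>* (b \<^bold>* b) = b"
    and ab: "a \<^bold>* a = b \<^bold>* a"
begin

private lemma x': "x \<^bold>* (a \<^bold>* (a \<^bold>* w)) = a \<^bold>* w" "a \<^bold>* (x \<^bold>* (x \<^bold>* w)) = x \<^bold>* w"
  using x[THEN arg_cong, of "\<lambda>z. z \<^bold>* w"] by (simp_all only: assoc)

private lemma ba: "b \<^bold>* a = a \<^bold>* a" "b \<^bold>* (a \<^bold>* w) = a \<^bold>* (a \<^bold>* w)"
  using ab[symmetric] arg_cong[OF ab[symmetric], of "\<lambda>z. z \<^bold>* w"] by (simp_all only: assoc[symmetric])

private lemma bx: "b \<^bold>* x = a \<^bold>* x" "b \<^bold>* (x \<^bold>* w) = a \<^bold>* (x \<^bold>* w)"
proof -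
  show bx: "b \<^bold>* x = a \<^bold>* x"
    using ba(2)[of "x \<^bold>* x"] by (simp only: x)
  show "b \<^bold>* (x \<^bold>* w) = a \<^bold>* (x \<^bold>* w)"
    using arg_cong[OF bx, of "\<lambda>z. z \<^bold>* w"] by (simp only: assoc)
qed

text \<open>The rewriting of \<open>a\<close> as \<open>b a x\<^sup>2 a\<close> places the range of \<open>a\<close> inside that of \<open>b\<close>, where
  \<open>y b\<close> acts as the identity.\<close>

private lemma ya: "y \<^bold>* (a \<^bold>* a) = a"
proof -
  have "y \<^bold>* (a \<^bold>* a) = y \<^bold>* (b \<^bold>* a)"
    by (simp only: ab)
  also have "\<dots> = y \<^bold>* (b \<^bold>* (b \<^bold>* (a \<^bold>* (x \<^bold>* (x \<^bold>* a)))))"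
    using core_inverse_inner(1)[OF x] by (simp only: bx x')
  also have "\<dots> = (y \<^bold>* (b \<^bold>* b)) \<^bold>* (a \<^bold>* (x \<^bold>* (x \<^bold>* a)))"
    by (simp only: assoc)
  also have "\<dots> = b \<^bold>* (x \<^bold>* a)"
    by (simp add: y x')
  also have "\<dots> = a"
    using core_inverse_inner(1)[OF x] by (simp add: bx)
  finally show ?thesis .
qed

lemma core_inverse_mult_eq: "y \<^bold>* x = x \<^bold>* x"
proof -
  have "y \<^bold>* x = y \<^bold>* (a \<^bold>* a) \<^bold>* (x \<^bold>* (x \<^bold>* x))"
    by (simp add: assoc x x')
  then show ?thesis
    by (simp only: ya) (simp add: x')
qed

lemma core_inverse_projection_mult_eq: "b \<^bold>* (y \<^bold>* x) = x"
  by (simp add: core_inverse_mult_eq bx x)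

private lemma bya: "b \<^bold>* (y \<^bold>* (a \<^bold>* w)) = a \<^bold>* w"
proof -
  have "b \<^bold>* (y \<^bold>* (a \<^bold>* w)) = b \<^bold>* (y \<^bold>* x) \<^bold>* (a \<^bold>* (a \<^bold>* w))"
    by (simp only: assoc x')
  then show ?thesis
    by (simp only: core_inverse_projection_mult_eq x')
qed

lemma core_inverse_of_mult:
  shows "(a \<^bold>* b) \<^bold>* (x \<^bold>* x) = a \<^bold>* x"
    and "(x \<^bold>* x) \<^bold>* ((a \<^bold>* b) \<^bold>* (a \<^bold>* b)) = a \<^bold>* b"
    and "(a \<^bold>* b) \<^bold>* ((x \<^bold>* x) \<^bold>* (x \<^bold>* x)) = x \<^bold>* x"
  by (simp_all add: assoc bx ba x x')

lemma core_inverse_of_mult_projection: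
  shows "(a \<^bold>* b \<^bold>* y) \<^bold>* x = a \<^bold>* x"
    and "x \<^bold>* ((a \<^bold>* b \<^bold>* y) \<^bold>* (a \<^bold>* b \<^bold>* y)) = a \<^bold>* b \<^bold>* y"
    and "(a \<^bold>* b \<^bold>* y) \<^bold>* (x \<^bold>* x) = x"
proof -
  show p: "(a \<^bold>* b \<^bold>* y) \<^bold>* x = a \<^bold>* x"
    by (simp add: assoc core_inverse_projection_mult_eq)
  show "x \<^bold>* ((a \<^bold>* b \<^bold>* y) \<^bold>* (a \<^bold>* b \<^bold>* y)) = a \<^bold>* b \<^bold>* y"
    by (simp add: assoc bya x')
  show "(a \<^bold>* b \<^bold>* y) \<^bold>* (x \<^bold>* x) = x"
    using arg_cong[OF p, of "\<lambda>z. z \<^bold>* x"] by (simp only: assoc x)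
qed

end

end


section \<open>Linear dependence\<close>

text \<open>More vectors than coordinates are linearly dependent. The vectors \<open>v j\<close> are indexed, so
  that repetitions among them count as dependence.\<close>

lemma exists_linear_dependence:
  fixes v :: "'j \<Rightarrow> 'i \<Rightarrow> 'a::field"
  assumes "finite I" and "finite J" and "card I < card J"
  shows "\<exists>c. (\<exists>j\<in>J. c j \<noteq> 0) \<and> (\<forall>i\<in>I. (\<Sum>j\<in>J. c j * v j i) = 0)"
  using assms
proof (induction I arbitrary: J v rule: finite_induct)
  case empty
  then obtain j where "j \<in> J" by fastforce
  then show ?case by (intro exI[of _ "\<lambda>_. 1"]) auto
next
  case (insert x I)
  show ?case
  proof (cases "\<forall>j\<in>J. v j x = 0")
    case True
    from insert obtain c where "\<exists>j\<in>J. c j \<noteq> 0" "\<forall>i\<in>I. (\<Sum>j\<in>J. c j * v j i) = 0"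
      by (metis card_insert_disjoint lessI order_less_trans)
    with True show ?thesis by (intro exI[of _ c]) auto
  next
    case False
    then obtain p where p: "p \<in> J" "v p x \<noteq> 0" by blast
    \<comment> \<open>Eliminate the coordinate \<open>x\<close> with the pivot vector \<open>v p\<close>.\<close>
    define w where "w j i = v j i - v j x / v p x * v p i" for j i
    have "card I < card (J - {p})"
      using insert p by simp
    then obtain c where c: "\<exists>j\<in>J - {p}. c j \<noteq> 0"
      "\<And>i. i \<in> I \<Longrightarrow> (\<Sum>j\<in>J - {p}. c j * w j i) = 0"
      using insert.IH[of "J - {p}" w] insert.prems by blast
    define c' where "c' = c(p := - (\<Sum>j\<in>J - {p}. c j * v j x / v p x))"
    have "(\<Sum>j\<in>J. c' j * v j i) = (\<Sum>j\<in>J - {p}. c j * w j i)" for i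
    proof -
      have "(\<Sum>j\<in>J. c' j * v j i) = c' p * v p i + (\<Sum>j\<in>J - {p}. c' j * v j i)"
        using p insert.prems by (simp add: sum.remove)
      also have "(\<Sum>j\<in>J - {p}. c' j * v j i) = (\<Sum>j\<in>J - {p}. c j * v j i)"
        by (intro sum.cong) (auto simp: c'_def)
      also have "c' p * v p i = - (\<Sum>j\<in>J - {p}. c j * (v j x / v p x * v p i))"
        by (simp add: c'_def sum_distrib_right mult.assoc)
      finally show ?thesis
        by (simp add: w_def right_diff_distrib sum_subtractf)
    qed
    moreover have "w j x = 0" for j
      using p by (simp add: w_def)
    ultimately have "\<forall>i\<in>insert x I. (\<Sum>j\<in>J. c' j * v j i) = 0"
      using c(2) by simp
    moreover have "\<exists>j\<in>J. c' j \<noteq> 0"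
      using c(1) by (auto simp: c'_def)
    ultimately show ?thesis by blast
  qed
qed


section \<open>The Einstein product\<close>

context
  fixes N :: "nat \<Rightarrow> nat" and n :: nat
begin

private abbreviation "I \<equiv> multi_indices N n"
private abbreviation "T \<equiv> tensors N n"
private abbreviation einstein_infix (infixl "\<star>" 70) where "A \<star> B \<equiv> einstein N n A B"
private abbreviation "pow \<equiv> tensor_power N n"
private abbreviation "adj \<equiv> conj_transpose N n"
private abbreviation "app \<equiv> einstein_apply N n"

lemma finite_multi_indices: "finite I"
  by (auto simp: multi_indices_def intro: finite_PiE)

lemma einstein_entry: "i \<in> I \<Longrightarrow> j \<in> I \<Longrightarrow> (A \<star> B) (i, j) = (\<Sum>k\<in>I. A (i, k) * B (k, j))"
  by (simp add: einstein_def)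

lemma conj_transpose_entry: "i \<in> I \<Longrightarrow> j \<in> I \<Longrightarrow> adj A (i, j) = cnj (A (j, i))"
  by (simp add: conj_transpose_def)

lemma tensors_eqI:
  assumes "A \<in> T" "B \<in> T" "\<And>i j. i \<in> I \<Longrightarrow> j \<in> I \<Longrightarrow> A (i, j) = B (i, j)"
  shows "A = B"
  using assms unfolding tensors_def by (intro PiE_ext) auto

lemma tensor_closed [simp]:
  "A \<star> B \<in> T" "adj A \<in> T" "tensor_id N n \<in> T"
  by (auto simp: tensors_def einstein_def conj_transpose_def tensor_id_def)

lemma tensor_power_closed [simp]: "pow A k \<in> T"
  by (cases k) auto

lemma einstein_assoc: "A \<star> B \<star> C = A \<star> (B \<star> C)"
proof (rule tensors_eqI)
  fix i j assume ij: "i \<in> I" "j \<in> I"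
  have "(A \<star> B \<star> C) (i, j) = (\<Sum>k\<in>I. \<Sum>l\<in>I. A (i, l) * B (l, k) * C (k, j))"
    using ij by (simp add: einstein_entry sum_distrib_right)
  also have "\<dots> = (\<Sum>l\<in>I. \<Sum>k\<in>I. A (i, l) * B (l, k) * C (k, j))"
    by (rule sum.swap)
  also have "\<dots> = (A \<star> (B \<star> C)) (i, j)"
    using ij by (simp add: einstein_entry sum_distrib_left mult.assoc)
  finally show "(A \<star> B \<star> C) (i, j) = (A \<star> (B \<star> C)) (i, j)" .
qed auto

lemma semigroup_einstein: "semigroup (einstein N n)"
  by unfold_locales (rule einstein_assoc)

lemma einstein_id [simp]:
  assumes "A \<in> T"
  shows "tensor_id N n \<star> A = A" "A \<star> tensor_id N n = A"
proof -
  have "(\<Sum>k\<in>I. (if i = k then 1 else 0) * f k) = f i"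
    "(\<Sum>k\<in>I. f k * (if k = i then 1 else 0)) = f i"
    if "i \<in> I" for f :: "multi_index \<Rightarrow> complex" and i
    using that finite_multi_indices by (simp_all add: if_distrib if_distribR cong: if_cong)
  then show "tensor_id N n \<star> A = A" "A \<star> tensor_id N n = A"
    using assms by (auto intro!: tensors_eqI simp: einstein_entry tensor_id_def)
qed

lemma tensor_power_one: "A \<in> T \<Longrightarrow> pow A 1 = A"
  by simp

lemma tensor_power_two: "pow A 2 = A \<star> A"
  by (simp add: numeral_2_eq_2 einstein_assoc)

lemma tensor_power_add: "pow A (k + l) = pow A k \<star> pow A l"
  by (induction l) (simp_all add: einstein_assoc)

lemma conj_transpose_einstein: "adj (A \<star> B) = adj B \<star> adj A"
  by (rule tensors_eqI)
    (auto simp: einstein_entry conj_transpose_entry mult.commute intro!: sum.cong)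

lemma conj_transpose_involutive: "A \<in> T \<Longrightarrow> adj (adj A) = A"
  by (rule tensors_eqI) (auto simp: conj_transpose_entry)

text \<open>The cancellation law behind the identity of the kernels of \<open>A\<close> and \<open>A\<^sup>* A\<close>: the columns of
  \<open>A \<star> U - A \<star> W\<close> lie in the range of \<open>A\<close> and are orthogonal to it.\<close>

lemma conj_transpose_cancel:
  assumes "adj A \<star> (A \<star> U) = adj A \<star> (A \<star> W)"
  shows "A \<star> U = A \<star> W"
proof (rule tensors_eqI)
  fix i j assume ij: "i \<in> I" "j \<in> I"
  define d where "d i = (A \<star> U) (i, j) - (A \<star> W) (i, j)" for i
  have d_eq: "d i = (\<Sum>k\<in>I. A (i, k) * (U (k, j) - W (k, j)))" if "i \<in> I" for i
    using that ij by (simp add: d_def einstein_entry right_diff_distrib sum_subtractf)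
  have orth: "(\<Sum>i\<in>I. cnj (A (i, k)) * d i) = 0" if "k \<in> I" for k
  proof -
    have "(\<Sum>i\<in>I. cnj (A (i, k)) * d i)
        = (adj A \<star> (A \<star> U)) (k, j) - (adj A \<star> (A \<star> W)) (k, j)"
      using that ij einstein_entry[of k j "adj A"]
      by (simp add: conj_transpose_entry d_def right_diff_distrib sum_subtractf)
    then show ?thesis using assms by simp
  qed
  have "(\<Sum>i\<in>I. cnj (d i) * d i)
      = (\<Sum>i\<in>I. \<Sum>k\<in>I. cnj (U (k, j) - W (k, j)) * (cnj (A (i, k)) * d i))"
  proof (intro sum.cong refl)
    fix i assume "i \<in> I"
    then have "cnj (d i) = (\<Sum>k\<in>I. cnj (U (k, j) - W (k, j)) * cnj (A (i, k)))"
      by (simp add: d_eq mult.commute)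
    then show "cnj (d i) * d i = (\<Sum>k\<in>I. cnj (U (k, j) - W (k, j)) * (cnj (A (i, k)) * d i))"
      by (simp only: sum_distrib_right mult.assoc)
  qed
  also have "\<dots> = (\<Sum>k\<in>I. \<Sum>i\<in>I. cnj (U (k, j) - W (k, j)) * (cnj (A (i, k)) * d i))"
    by (rule sum.swap)
  also have "\<dots> = 0"
    by (simp add: sum_distrib_left[symmetric] orth)
  finally have "(\<Sum>i\<in>I. complex_of_real ((cmod (d i))\<^sup>2)) = 0"
    by (simp only: complex_norm_square mult.commute[of "cnj _"])
  then have "(\<Sum>i\<in>I. (cmod (d i))\<^sup>2) = 0"
    by (metis of_real_sum of_real_eq_0_iff)
  then have "d i = 0"
    using ij finite_multi_indices by (simp add: sum_nonneg_eq_0_iff)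
  then show "(A \<star> U) (i, j) = (A \<star> W) (i, j)"
    by (simp add: d_def)
qed auto


section \<open>Powers and the index\<close>

text \<open>The linear combination \<open>\<Sum>t\<in>J. c t * P t\<close> of tensors.\<close>

private definition lincomb :: "(nat \<Rightarrow> complex) \<Rightarrow> (nat \<Rightarrow> ctensor) \<Rightarrow> nat set \<Rightarrow> ctensor" where
  "lincomb c P J = (\<lambda>(i, j) \<in> I \<times> I. \<Sum>t\<in>J. c t * P t (i, j))"

private lemma lincomb_entry:
  "i \<in> I \<Longrightarrow> j \<in> I \<Longrightarrow> lincomb c P J (i, j) = (\<Sum>t\<in>J. c t * P t (i, j))"
  by (simp add: lincomb_def)

private lemma lincomb_closed: "lincomb c P J \<in> T"
  by (auto simp: tensors_def lincomb_def)

private lemma einstein_lincomb: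
  shows "A \<star> lincomb c P J = lincomb c (\<lambda>t. A \<star> P t) J"
    and "lincomb c P J \<star> A = lincomb c (\<lambda>t. P t \<star> A) J"
proof -
  show "A \<star> lincomb c P J = lincomb c (\<lambda>t. A \<star> P t) J"
  proof (rule tensors_eqI)
    fix i j assume ij: "i \<in> I" "j \<in> I"
    have "(A \<star> lincomb c P J) (i, j) = (\<Sum>k\<in>I. \<Sum>t\<in>J. A (i, k) * (c t * P t (k, j)))"
      using ij by (simp add: einstein_entry lincomb_entry sum_distrib_left)
    also have "\<dots> = (\<Sum>t\<in>J. \<Sum>k\<in>I. A (i, k) * (c t * P t (k, j)))"
      by (rule sum.swap)
    finally show "(A \<star> lincomb c P J) (i, j) = lincomb c (\<lambda>t. A \<star> P t) J (i, j)"
      using ij by (simp add: einstein_entry lincomb_entry sum_distrib_left mult_ac)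
  qed (auto simp: lincomb_closed)
  show "lincomb c P J \<star> A = lincomb c (\<lambda>t. P t \<star> A) J"
  proof (rule tensors_eqI)
    fix i j assume ij: "i \<in> I" "j \<in> I"
    have "(lincomb c P J \<star> A) (i, j) = (\<Sum>k\<in>I. \<Sum>t\<in>J. c t * P t (i, k) * A (k, j))"
      using ij by (simp add: einstein_entry lincomb_entry sum_distrib_right)
    also have "\<dots> = (\<Sum>t\<in>J. \<Sum>k\<in>I. c t * P t (i, k) * A (k, j))"
      by (rule sum.swap)
    finally show "(lincomb c P J \<star> A) (i, j) = lincomb c (\<lambda>t. P t \<star> A) J (i, j)"
      using ij by (simp add: einstein_entry lincomb_entry sum_distrib_left mult_ac)
  qed (auto simp: lincomb_closed)
qed

text \<open>The powers of \<open>M\<close> are linearly dependent, so \<open>M\<close> is annihilated by a nonzero polynomial.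
  Dividing by its coefficient of lowest degree \<open>k\<close> expresses \<open>M\<^sup>k\<close> as \<open>M\<^sup>k\<^sup>+\<^sup>1\<close> times a
  polynomial in \<open>M\<close>.\<close>

lemma tensor_power_eventually_divisible:
  assumes "M \<in> T"
  shows "\<exists>k S. S \<in> T \<and> M \<star> S = S \<star> M \<and> pow M k = pow M (Suc k) \<star> S"
proof -
  define d where "d = card (I \<times> I)"
  have "finite (I \<times> I)"
    using finite_multi_indices by simp
  from exists_linear_dependence[OF this, of "{..d}" "\<lambda>t ij. pow M t ij"]
  obtain c where c: "\<exists>t\<in>{..d}. c t \<noteq> 0"
    "\<forall>ij\<in>I \<times> I. (\<Sum>t\<le>d. c t * pow M t ij) = 0"
    by (auto simp: d_def)
  define k where "k = (LEAST t. c t \<noteq> 0)"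
  obtain t where t: "c t \<noteq> 0" "t \<le> d"
    using c(1) by blast
  have k: "c k \<noteq> 0" "k \<le> d"
    using LeastI[of "\<lambda>t. c t \<noteq> 0", OF t(1)] Least_le[of "\<lambda>t. c t \<noteq> 0", OF t(1)] t(2)
    by (simp_all add: k_def)
  have below: "c t = 0" if "t < k" for t
    using that not_less_Least k_def by blast
  define S where "S = lincomb (\<lambda>t. - c (t + Suc k) / c k) (pow M) {..<d - k}"
  have "M \<star> pow M t = pow M t \<star> M" for t
    using assms by (induction t) (simp_all add: einstein_assoc[symmetric])
  then have comm: "M \<star> S = S \<star> M"
    by (simp add: S_def einstein_lincomb)
  have "pow M k = pow M (Suc k) \<star> S"
  proof (rule tensors_eqI)
    fix i j assume ij: "i \<in> I" "j \<in> I"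
    have "0 = (\<Sum>t\<le>d. c t * pow M t (i, j))"
      using c(2) ij by simp
    also have "\<dots> = (\<Sum>t\<in>{k..d}. c t * pow M t (i, j))"
      by (rule sum.mono_neutral_right) (auto simp: below)
    also have "\<dots> = c k * pow M k (i, j) + (\<Sum>t\<in>{Suc k..d}. c t * pow M t (i, j))"
      using k by (simp add: sum.atLeast_Suc_atMost)
    also have "(\<Sum>t\<in>{Suc k..d}. c t * pow M t (i, j))
        = (\<Sum>t\<in>{..<d - k}. c (t + Suc k) * pow M (t + Suc k) (i, j))"
      by (rule sum.reindex_bij_witness[of _ "\<lambda>t. t + Suc k" "\<lambda>t. t - Suc k"]) auto
    finally have "pow M k (i, j)
        = (\<Sum>t\<in>{..<d - k}. - c (t + Suc k) / c k * pow M (t + Suc k) (i, j))"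
      using k by (simp add: sum_divide_distrib[symmetric] sum_negf field_simps eq_neg_iff_add_eq_0)
    then show "pow M k (i, j) = (pow M (Suc k) \<star> S) (i, j)"
      using ij unfolding S_def einstein_lincomb
      by (simp only: lincomb_entry tensor_power_add[symmetric] add.commute)
  qed auto
  with comm show ?thesis
    using S_def lincomb_closed by blast
qed

lemma einstein_apply_einstein: "app (A \<star> B) X = app A (app B X)"
proof
  fix i
  show "app (A \<star> B) X i = app A (app B X) i"
  proof (cases "i \<in> I")
    case True
    have "app (A \<star> B) X i = (\<Sum>k\<in>I. \<Sum>l\<in>I. A (i, l) * B (l, k) * X k)"
      using True by (simp add: einstein_apply_def einstein_entry sum_distrib_right)
    also have "\<dots> = (\<Sum>l\<in>I. \<Sum>k\<in>I. A (i, l) * B (l, k) * X k)"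
      by (rule sum.swap)
    also have "\<dots> = app A (app B X) i"
      using True by (simp add: einstein_apply_def sum_distrib_left mult.assoc)
    finally show ?thesis .
  qed (simp add: einstein_apply_def)
qed

lemma tensor_range_einstein_subset: "tensor_range N n (A \<star> B) \<subseteq> tensor_range N n A"
proof -
  have "app B X \<in> vtensors N n" for X
    by (simp add: einstein_apply_def vtensors_def)
  then show ?thesis
    by (auto simp: tensor_range_def einstein_apply_einstein)
qed

lemma factor_of_tensor_range_subset:
  assumes "A \<in> T" and "tensor_range N n A \<subseteq> tensor_range N n B"
  shows "\<exists>W\<in>T. A = B \<star> W"
proof -
  define e where "e j = (\<lambda>i\<in>I. if i = j then 1 else 0 :: complex)" for j
  have "\<exists>w. app A (e j) = app B w" for j
  proof -
    have "app A (e j) \<in> tensor_range N n A"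
      by (auto simp: tensor_range_def e_def vtensors_def)
    then show ?thesis
      using assms(2) by (auto simp: tensor_range_def)
  qed
  then obtain w where w: "\<And>j. app A (e j) = app B (w j)"
    by metis
  define W where "W = (\<lambda>(k, j) \<in> I \<times> I. w j k)"
  have "A = B \<star> W"
  proof (rule tensors_eqI)
    fix i j assume ij: "i \<in> I" "j \<in> I"
    have "A (i, j) = app A (e j) i"
      using ij finite_multi_indices
      by (simp add: einstein_apply_def e_def if_distrib[of "(*) _"] cong: if_cong)
    also have "\<dots> = (B \<star> W) (i, j)"
      unfolding w using ij by (simp add: einstein_apply_def einstein_entry W_def)
    finally show "A (i, j) = (B \<star> W) (i, j)" .
  qed (use assms in auto)
  moreover have "W \<in> T"
    by (auto simp: tensors_def W_def)
  ultimately show ?thesis by blast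
qed

lemma tensor_ind_eq_one_iff:
  assumes "A \<in> T"
  shows "tensor_ind N n A = 1 \<longleftrightarrow> (\<exists>W\<in>T. A = A \<star> A \<star> W)"
proof
  let ?P = "\<lambda>k. k \<ge> 1 \<and> tensor_range N n (pow A k) = tensor_range N n (pow A (k + 1))"
  have range_le: "tensor_range N n (pow A (k + 1)) \<subseteq> tensor_range N n (pow A k)" for k
    by (simp add: tensor_range_einstein_subset)
  {
    assume ind: "tensor_ind N n A = 1"
    \<comment> \<open>The ranges of the powers stabilise, so the minimum defining the index is attained.\<close>
    obtain k S where S: "A \<star> S = S \<star> A" "pow A k = pow A (Suc k) \<star> S"
      using tensor_power_eventually_divisible[OF assms] by blast
    have "pow A (Suc k) = pow A (Suc k + 1) \<star> S"
      by (metis S einstein_assoc tensor_power.simps(2) Suc_eq_plus1)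
    then have "?P (Suc k)"
      using range_le[of "Suc k"] tensor_range_einstein_subset[of "pow A (Suc k + 1)" S] by auto
    then have "?P (tensor_ind N n A)"
      unfolding tensor_ind_def by (rule LeastI)
    then have "tensor_range N n A \<subseteq> tensor_range N n (A \<star> A)"
      using assms by (simp add: ind)
    then show "\<exists>W\<in>T. A = A \<star> A \<star> W"
      using assms factor_of_tensor_range_subset by blast
  }
  assume "\<exists>W\<in>T. A = A \<star> A \<star> W"
  then have "tensor_range N n A \<subseteq> tensor_range N n (A \<star> A)"
    using tensor_range_einstein_subset by metis
  then have "?P 1"
    using assms range_le[of 1] by auto
  then show "tensor_ind N n A = 1"
    unfolding tensor_ind_def by (intro Least_equality) auto
qed


section \<open>Existence and uniqueness of the core inverse\<close>

lemma is_core_inverse_iff: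
  "is_core_inverse N n A X \<longleftrightarrow>
     X \<in> T \<and> adj (A \<star> X) = A \<star> X \<and> X \<star> (A \<star> A) = A \<and> A \<star> (X \<star> X) = X"
  by (simp add: is_core_inverse_def tensor_power_two)

lemma is_core_inverse_unique:
  assumes X: "is_core_inverse N n A X" and Y: "is_core_inverse N n A Y"
  shows "X = Y"
proof -
  interpret semigroup "einstein N n" by (rule semigroup_einstein)
  note X = X[unfolded is_core_inverse_iff] and Y = Y[unfolded is_core_inverse_iff]
  have "A \<star> X \<star> A = A" "A \<star> Y \<star> A = A"
    using X Y core_inverse_inner(1) einstein_assoc by metis+
  then have XY: "A \<star> X \<star> (A \<star> Y) = A \<star> Y" "A \<star> Y \<star> (A \<star> X) = A \<star> X"
    by (metis einstein_assoc)+
  \<comment> \<open>Both are the orthogonal projector onto the range of \<open>A\<close>.\<close>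
  have "A \<star> X = A \<star> Y"
    using XY X Y conj_transpose_einstein by metis
  then show ?thesis
    using X Y core_inverse_eqI by blast
qed

lemma core_inverse_eq: "is_core_inverse N n A X \<Longrightarrow> core_inverse N n A = X"
  unfolding core_inverse_def using is_core_inverse_unique by blast

lemma tensor_ind_of_core_inverse:
  assumes "A \<in> T" and "is_core_inverse N n A X"
  shows "tensor_ind N n A = 1"
proof -
  note X = assms(2)[unfolded is_core_inverse_iff]
  have "A = X \<star> (A \<star> A)" "X = A \<star> A \<star> (X \<star> (X \<star> X))"
    using X by (metis einstein_assoc)+
  then have "A = A \<star> A \<star> (X \<star> (X \<star> X) \<star> (A \<star> A))"
    by (metis einstein_assoc)
  then show ?thesis
    using tensor_ind_eq_one_iff[OF assms(1)] tensor_closed(1) by blast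
qed

text \<open>The self-adjoint idempotent \<open>A \<star> K\<close> is the orthogonal projector onto the range of \<open>A\<close>.\<close>

lemma exists_range_projector:
  assumes A: "A \<in> T"
  shows "\<exists>K\<in>T. A \<star> K \<star> A = A \<and> adj (A \<star> K) = A \<star> K"
proof -
  define H where "H = adj A \<star> A"
  have H: "H \<in> T" "adj H = H"
    using A by (simp_all add: H_def conj_transpose_einstein conj_transpose_involutive)
  obtain k S where S: "S \<in> T" "H \<star> S = S \<star> H" "pow H k = pow H (Suc k) \<star> S"
    using tensor_power_eventually_divisible[OF H(1)] by blast
  have powH: "pow H (Suc l) = H \<star> pow H l" for l
    using tensor_power_add[of H 1 l] H by simp
  \<comment> \<open>As \<open>H\<close> is self-adjoint, cancellation brings the exponent down to 1.\<close>
  have step: "pow H (Suc l) = pow H (Suc (Suc l)) \<star> S"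
    if "pow H (Suc (Suc l)) = pow H (Suc (Suc (Suc l))) \<star> S" for l
  proof -
    have "adj H \<star> (H \<star> pow H l) = adj H \<star> (H \<star> (pow H (Suc l) \<star> S))"
      using that by (simp only: powH H einstein_assoc)
    from conj_transpose_cancel[OF this] show ?thesis
      unfolding powH einstein_assoc .
  qed
  have "pow H (Suc k) = pow H (Suc (Suc k)) \<star> S"
    using S(3) by (metis powH einstein_assoc)
  then have "pow H (Suc 0) = pow H (Suc (Suc 0)) \<star> S"
  proof (induction k)
    case (Suc k)
    then show ?case using step by blast
  qed
  then have "pow H 1 = pow H 2 \<star> S"
    unfolding One_nat_def numeral_2_eq_2 .
  then have HS: "H = H \<star> S \<star> H"
    using H S by (metis tensor_power_one tensor_power_two einstein_assoc)
  define K where "K = S \<star> adj A"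
  have "adj A \<star> (A \<star> tensor_id N n) = adj A \<star> (A \<star> (S \<star> H))"
    using HS A by (simp add: H_def einstein_assoc)
  then have "A \<star> tensor_id N n = A \<star> (S \<star> H)"
    by (rule conj_transpose_cancel)
  then have AKA: "A \<star> K \<star> A = A"
    using A by (simp add: H_def K_def einstein_assoc)
  \<comment> \<open>With \<open>Q = A \<star> K\<close>, this gives \<open>Q = Q \<star> Q\<^sup>*\<close>, whence \<open>Q\<close> is self-adjoint.\<close>
  have "adj A \<star> adj (A \<star> K) = adj A"
    using AKA conj_transpose_einstein by metis
  then have "A \<star> K = A \<star> K \<star> adj (A \<star> K)"
    by (simp add: K_def einstein_assoc)
  then have "adj (A \<star> K) = A \<star> K"
    using conj_transpose_einstein conj_transpose_involutive tensor_closed(1) by metis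
  with AKA show ?thesis
    using K_def tensor_closed(1) by blast
qed

text \<open>The range condition provides a factor on the right only. The commuting \<open>V\<close> comes from
  \<open>A\<^sup>k = A\<^sup>k\<^sup>+\<^sup>1 V\<close>, in which the extra powers are cancelled on the right by powers of \<open>W\<close>.\<close>

lemma exists_commuting_divisor_square:
  assumes A: "A \<in> T" and W: "A = A \<star> A \<star> W"
  shows "\<exists>V\<in>T. A \<star> V = V \<star> A \<and> V \<star> (A \<star> A) = A"
proof -
  obtain k V where V: "V \<in> T" "A \<star> V = V \<star> A" "pow A k = pow A (Suc k) \<star> V"
    using tensor_power_eventually_divisible[OF A] by blast
  have comm: "pow A l \<star> V = V \<star> pow A l" for l
    using V(1,2) by (induction l) (simp, metis einstein_assoc tensor_power.simps(2))
  have "\<exists>R\<in>T. A = pow A (Suc l) \<star> R" for l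
  proof (induction l)
    case 0
    show ?case using A by (intro bexI[of _ "tensor_id N n"]) auto
  next
    case (Suc l)
    then obtain R where "R \<in> T" "A = pow A (Suc l) \<star> R" by blast
    have "pow A (Suc l) = pow A (Suc (Suc l)) \<star> W"
      using W by (metis einstein_assoc tensor_power.simps(2))
    then have "A = pow A (Suc (Suc l)) \<star> (W \<star> R)"
      using \<open>A = pow A (Suc l) \<star> R\<close> by (metis einstein_assoc)
    then show ?case using tensor_closed(1) by blast
  qed
  then obtain R where R: "A = pow A (Suc k) \<star> R" by blast
  have "pow A (Suc k) = V \<star> A \<star> pow A (Suc k)"
  proof -
    have "pow A (Suc k) = A \<star> pow A k"
      using tensor_power_add[of A 1 k] A by simp
    then show ?thesis
      using V comm by (metis einstein_assoc)
  qed
  then have "V \<star> (A \<star> A) = A"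
    using R by (metis einstein_assoc)
  with V show ?thesis by blast
qed

text \<open>If \<open>Q = A \<star> K\<close> is the projector onto the range of \<open>A\<close> and \<open>A \<star> V \<star> V\<close> the group inverse
  of \<open>A\<close>, then \<open>A \<star> V \<star> V \<star> Q\<close> is the core inverse.\<close>

lemma core_tensor_is_core_inverse:
  assumes "core_tensor N n A"
  shows "is_core_inverse N n A (core_inverse N n A)"
proof -
  have A: "A \<in> T" and "\<exists>W\<in>T. A = A \<star> A \<star> W"
    using assms tensor_ind_eq_one_iff by (auto simp: core_tensor_def)
  then obtain V where V: "A \<star> V = V \<star> A" "V \<star> (A \<star> A) = A"
    using exists_commuting_divisor_square by blast
  obtain K where K: "A \<star> K \<star> A = A" "adj (A \<star> K) = A \<star> K"
    using exists_range_projector[OF A] by blast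
  define X where "X = A \<star> V \<star> V \<star> (A \<star> K)"
  have VAA: "V \<star> (A \<star> (A \<star> Z)) = A \<star> Z" for Z
    using V(2) by (metis einstein_assoc)
  have AV: "A \<star> (V \<star> Z) = V \<star> (A \<star> Z)" for Z
    using V(1) by (metis einstein_assoc)
  have AKA: "A \<star> (K \<star> A) = A" "A \<star> (K \<star> (A \<star> Z)) = A \<star> Z" for Z
    using K(1) by (metis einstein_assoc)+
  have XVK: "X = V \<star> (A \<star> K)"
    by (simp add: X_def einstein_assoc AV VAA)
  have AX: "A \<star> X = A \<star> K"
    by (simp add: XVK AV VAA)
  have "X \<star> (A \<star> A) = A"
    by (simp add: XVK einstein_assoc AKA V)
  moreover have "A \<star> (X \<star> X) = X"
  proof -
    have "A \<star> (X \<star> X) = A \<star> K \<star> X"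
      by (metis AX einstein_assoc)
    then show ?thesis
      by (simp add: X_def einstein_assoc AKA)
  qed
  ultimately have "is_core_inverse N n A X"
    using AX K(2) by (simp add: is_core_inverse_iff X_def)
  then show ?thesis
    using core_inverse_eq by metis
qed

end


section \<open>Products of core tensors\<close>

theorem theorem3p8:
  fixes N :: "nat \<Rightarrow> nat" and n :: nat and A B :: ctensor
  assumes "A \<in> tensors N n" and "B \<in> tensors N n"
    and "core_tensor N n A" and "core_tensor N n B"
    and "tensor_power N n A 2 = einstein N n B A"
  shows "(tensor_ind N n (einstein N n A B) = 1 \<and>
          core_inverse N n (einstein N n A B)
            = einstein N n (core_inverse N n B) (core_inverse N n A)) \<and>
         (tensor_ind N n (einstein N n (einstein N n A B) (core_inverse N n B)) = 1 \<and>
          core_inverse N n (einstein N n (einstein N n A B) (core_inverse N n B))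
            = einstein N n (einstein N n B (core_inverse N n B)) (core_inverse N n A))"
proof -
  interpret semigroup "einstein N n" by (rule semigroup_einstein)
  define X where "X = core_inverse N n A"
  define Y where "Y = core_inverse N n B"
  have X: "X \<in> tensors N n" "conj_transpose N n (einstein N n A X) = einstein N n A X"
    "einstein N n X (einstein N n A A) = A" "einstein N n A (einstein N n X X) = X"
    using core_tensor_is_core_inverse[OF assms(3)] by (auto simp: X_def is_core_inverse_iff)
  have Y: "einstein N n Y (einstein N n B B) = B"
    using core_tensor_is_core_inverse[OF assms(4)] by (auto simp: Y_def is_core_inverse_iff)
  have AB: "einstein N n A A = einstein N n B A"
    using assms(5) by (simp add: tensor_power_two)
  note facts = X(3,4) Y AB
  have 1: "is_core_inverse N n (einstein N n A B) (einstein N n Y X)"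
    unfolding is_core_inverse_iff core_inverse_mult_eq[OF facts] core_inverse_of_mult[OF facts]
    by (simp add: X(2))
  have 2: "is_core_inverse N n (einstein N n (einstein N n A B) Y)
      (einstein N n (einstein N n B Y) X)"
    unfolding assoc[of B Y X] core_inverse_projection_mult_eq[OF facts]
      is_core_inverse_iff core_inverse_of_mult_projection[OF facts]
    by (simp add: X(1,2))
  show ?thesis
    using 1 2 tensor_ind_of_core_inverse core_inverse_eq tensor_closed(1)
    unfolding X_def Y_def by blast
qed

end
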